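(* Let $K$ be an infinite field, $S=K[x_1,\dots,x_m,y_1,\dots,y_n]$ the standard bigraded polynomial ring, $P=(x_1,\dots,x_m)$, $Q=(y_1,\dots,y_n)$, and let $M$ be a finitely generated bigraded $S$-module such that every cyclic submodule of $M$ is pure. Assume that $M$ is relative Cohen--Macaulay with respect to $P$ with $\operatorname{cd}(P,M)=p$ and relative unmixed with respect to $Q$ with $\operatorname{cd}(Q,M)=q$. Then $M$ is unmixed.
   Context: The bigrading on $S$ is given by $\deg x_i=(1,0)$ and $\deg y_j=(0,1)$. A submodule $N\subseteq M$ is pure if $N\otimes_S L\to M\otimes_S L$ is injective for every $S$-module $L$. For $J\in\{P,Q\}$ and a nonzero finitely generated bigraded $S$-module $M$, $\operatorname{grade}(J,M)$ is the least $i$ with $H^i_J(M)\ne 0$ and the cohomological dimension $\operatorname{cd}(J,M)$ is the largest $i$ with $H^i_J(M)\neq 0$. $M$ is relative Cohen--Macaulay with respect to $J$ if $\operatorname{grade}(J,M)=\operatorname{cd}(J,M)$. $M$ is relative unmixed with respect to $J$ if $\operatorname{cd}(J,M)=\operatorname{cd}(J,S/\mathfrak p)$ for all $\mathfrak p\in\operatorname{Ass}(M)$. $M$ is unmixed if $\dim S/\mathfrak p=\dim M$ for all $\mathfrak p\in\operatorname{Ass}(M)$. *)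

theory Defs
  imports "HOL-Algebra.Algebra" "HOL-Library.Extended_Nat"
begin

section \<open>The bigraded polynomial ring\<close>

text \<open>
  The variables are indexed by \<^typ>\<open>nat + nat\<close>: \<open>x\<^sub>i\<close> is the variable \<open>Inl i\<close> and \<open>y\<^sub>j\<close> the
  variable \<open>Inr j\<close>. A polynomial is a finitely supported map from monomials (finitely supported
  exponent maps) to coefficients.
\<close>

type_synonym monom2 = "nat + nat \<Rightarrow>\<^sub>0 nat"
type_synonym 'k poly2 = "monom2 \<Rightarrow>\<^sub>0 'k"

definition vars2 :: "nat \<Rightarrow> nat \<Rightarrow> (nat + nat) set" where
  "vars2 m n = Inl ` {1..m} \<union> Inr ` {1..n}"

definition bipoly_ring :: "nat \<Rightarrow> nat \<Rightarrow> ('k::field) poly2 ring" where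
  "bipoly_ring m n =
    \<lparr>carrier = {f. \<forall>t \<in> Poly_Mapping.keys f. Poly_Mapping.keys t \<subseteq> vars2 m n},
     monoid.mult = (*), one = 1, ring.zero = 0, ring.add = (+)\<rparr>"

definition Var2 :: "nat + nat \<Rightarrow> ('k::field) poly2" where
  "Var2 v = Poly_Mapping.single (Poly_Mapping.single v 1) 1"

definition ideal_P :: "nat \<Rightarrow> nat \<Rightarrow> ('k::field) poly2 set" where
  "ideal_P m n = Idl\<^bsub>bipoly_ring m n\<^esub> ((\<lambda>i. Var2 (Inl i)) ` {1..m})"

definition ideal_Q :: "nat \<Rightarrow> nat \<Rightarrow> ('k::field) poly2 set" where
  "ideal_Q m n = Idl\<^bsub>bipoly_ring m n\<^esub> ((\<lambda>j. Var2 (Inr j)) ` {1..n})"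

definition bidegree :: "nat \<Rightarrow> nat \<Rightarrow> monom2 \<Rightarrow> int \<times> int" where
  "bidegree m n t = (int (\<Sum>i=1..m. Poly_Mapping.lookup t (Inl i)),
                     int (\<Sum>j=1..n. Poly_Mapping.lookup t (Inr j)))"

definition bipoly_part :: "nat \<Rightarrow> nat \<Rightarrow> int \<times> int \<Rightarrow> ('k::field) poly2 set" where
  "bipoly_part m n d =
    {f \<in> carrier (bipoly_ring m n). \<forall>t \<in> Poly_Mapping.keys f. bidegree m n t = d}"

lemma bipoly_ring_cring: "cring (bipoly_ring m n :: ('k::field) poly2 ring)"
proof -
  let ?S = "bipoly_ring m n :: 'k poly2 ring"
  have add: "f + g \<in> carrier ?S" if "f \<in> carrier ?S" "g \<in> carrier ?S" for f g
    using that Poly_Mapping.keys_add[of f g] by (auto simp: bipoly_ring_def)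
  have mult: "f * g \<in> carrier ?S" if "f \<in> carrier ?S" "g \<in> carrier ?S" for f g
  proof -
    have "Poly_Mapping.keys t \<subseteq> vars2 m n" if t: "t \<in> Poly_Mapping.keys (f * g)" for t
    proof -
      obtain a b where "t = a + b" "a \<in> Poly_Mapping.keys f" "b \<in> Poly_Mapping.keys g"
        using keys_mult[of f g] t by blast
      then show ?thesis
        using \<open>f \<in> carrier ?S\<close> \<open>g \<in> carrier ?S\<close> Poly_Mapping.keys_add[of a b]
        by (fastforce simp: bipoly_ring_def)
    qed
    then show ?thesis by (simp add: bipoly_ring_def)
  qed
  have one: "(1 :: 'k poly2) \<in> carrier ?S"
    by (auto simp: bipoly_ring_def)
  show ?thesis
  proof (rule cringI)
    show "abelian_group ?S"
    proof (rule abelian_groupI)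
      fix f assume f: "f \<in> carrier ?S"
      show "\<exists>g\<in>carrier ?S. g \<oplus>\<^bsub>?S\<^esub> f = \<zero>\<^bsub>?S\<^esub>"
        using f by (intro bexI[of _ "- f"]) (auto simp: bipoly_ring_def)
    next
      show "f \<oplus>\<^bsub>?S\<^esub> g \<in> carrier ?S" if "f \<in> carrier ?S" "g \<in> carrier ?S" for f g
        using add[OF that] by (simp add: bipoly_ring_def)
    qed (simp_all add: bipoly_ring_def add.assoc add.commute)
    show "Group.comm_monoid ?S"
    proof (rule comm_monoidI)
      show "f \<otimes>\<^bsub>?S\<^esub> g \<in> carrier ?S" if "f \<in> carrier ?S" "g \<in> carrier ?S" for f g
        using mult[OF that] by (simp add: bipoly_ring_def)
    qed (use one in \<open>simp_all add: bipoly_ring_def mult.assoc mult.commute\<close>)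
  qed (simp add: bipoly_ring_def distrib_right)
qed

section \<open>Modules\<close>

definition annihilator :: "('r, 'c) ring_scheme \<Rightarrow> ('r, 'a) module \<Rightarrow> 'r set" where
  "annihilator R M = {a \<in> carrier R. \<forall>u \<in> carrier M. a \<odot>\<^bsub>M\<^esub> u = \<zero>\<^bsub>M\<^esub>}"

definition elem_annihilator :: "('r, 'c) ring_scheme \<Rightarrow> ('r, 'a) module \<Rightarrow> 'a \<Rightarrow> 'r set" where
  "elem_annihilator R M u = {a \<in> carrier R. a \<odot>\<^bsub>M\<^esub> u = \<zero>\<^bsub>M\<^esub>}"

definition finitely_generated :: "('r, 'c) ring_scheme \<Rightarrow> ('r, 'a) module \<Rightarrow> bool" where
  "finitely_generated R M \<longleftrightarrow>
    (\<exists>A. finite A \<and> A \<subseteq> carrier M \<and> (\<forall>N. submodule N R M \<and> A \<subseteq> N \<longrightarrow> N = carrier M))"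

definition cyclic_submodule :: "('r, 'c) ring_scheme \<Rightarrow> ('r, 'a) module \<Rightarrow> 'a \<Rightarrow> 'a set" where
  "cyclic_submodule R M u = {a \<odot>\<^bsub>M\<^esub> u | a. a \<in> carrier R}"

definition module_hom ::
  "('r, 'c) ring_scheme \<Rightarrow> ('r, 'a) module \<Rightarrow> ('r, 'b) module \<Rightarrow> ('a \<Rightarrow> 'b) set" where
  "module_hom R M N = {f \<in> carrier M \<rightarrow> carrier N.
     (\<forall>u \<in> carrier M. \<forall>v \<in> carrier M. f (u \<oplus>\<^bsub>M\<^esub> v) = f u \<oplus>\<^bsub>N\<^esub> f v) \<and>
     (\<forall>a \<in> carrier R. \<forall>u \<in> carrier M. f (a \<odot>\<^bsub>M\<^esub> u) = a \<odot>\<^bsub>N\<^esub> f u)}"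

text \<open>The cyclic module \<open>R/I\<close>; the ring structure is that of \<^term>\<open>R Quot I\<close>.\<close>

definition quotient_module :: "('r, 'c) ring_scheme \<Rightarrow> 'r set \<Rightarrow> ('r, 'r set) module" where
  "quotient_module R I =
    \<lparr>carrier = carrier (R Quot I), monoid.mult = monoid.mult (R Quot I), one = monoid.one (R Quot I),
     ring.zero = ring.zero (R Quot I), ring.add = ring.add (R Quot I),
     smult = (\<lambda>a C. (I +>\<^bsub>R\<^esub> a) \<otimes>\<^bsub>R Quot I\<^esub> C)\<rparr>"

lemma quotient_module_module:
  fixes R (structure)
  assumes "cring R" "ideal I R"
  shows "module R (quotient_module R I)"
proof -
  interpret R: cring R by fact
  interpret I: ideal I R by fact
  interpret Q: cring "R Quot I" using I.quotient_is_cring[OF \<open>cring R\<close>] .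
  have hom: "(+>\<^bsub>R\<^esub>) I \<in> ring_hom R (R Quot I)" by (rule I.rcos_ring_hom)
  note hs = ring_hom_closed[OF hom] ring_hom_add[OF hom] ring_hom_mult[OF hom] ring_hom_one[OF hom]
  have sel: "carrier (quotient_module R I) = carrier (R Quot I)"
    "\<And>a b. a \<oplus>\<^bsub>quotient_module R I\<^esub> b = a \<oplus>\<^bsub>R Quot I\<^esub> b"
    "\<zero>\<^bsub>quotient_module R I\<^esub> = \<zero>\<^bsub>R Quot I\<^esub>"
    "\<And>a b. a \<odot>\<^bsub>quotient_module R I\<^esub> b = (I +>\<^bsub>R\<^esub> a) \<otimes>\<^bsub>R Quot I\<^esub> b"
    by (simp_all add: quotient_module_def)
  show ?thesis
  proof (rule moduleI)
    show "abelian_group (quotient_module R I)"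
      by (rule abelian_groupI) (use Q.l_neg Q.a_inv_closed in \<open>auto simp: sel Q.add.m_ac\<close>)
  qed (use hs in \<open>auto simp: sel Q.l_distr Q.r_distr Q.m_assoc R.is_cring\<close>)
qed

definition bigraded_module ::
  "nat \<Rightarrow> nat \<Rightarrow> (('k::field) poly2, 'a) module \<Rightarrow> (int \<times> int \<Rightarrow> 'a set) \<Rightarrow> bool" where
  "bigraded_module m n M G \<longleftrightarrow>
     module (bipoly_ring m n) M \<and>
     (\<forall>d. subgroup (G d) (add_monoid M)) \<and>
     (\<forall>u \<in> carrier M. \<exists>!c. (\<forall>d. c d \<in> G d) \<and> finite {d. c d \<noteq> \<zero>\<^bsub>M\<^esub>} \<and>
        u = (\<Oplus>\<^bsub>M\<^esub> d \<in> {d. c d \<noteq> \<zero>\<^bsub>M\<^esub>}. c d)) \<and>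
     (\<forall>d e. \<forall>f \<in> bipoly_part m n d. \<forall>u \<in> G e. f \<odot>\<^bsub>M\<^esub> u \<in> G (fst d + fst e, snd d + snd e))"

section \<open>Tensor products and purity\<close>

text \<open>
  \<open>M \<otimes>\<^sub>R L\<close> is the free abelian group on pairs modulo the bilinearity relations. Injectivity of a
  map between tensor products only concerns the underlying abelian groups, so the scalar
  multiplication of the tensor product is not recorded.
\<close>

inductive_set tensor_relators ::
  "('r, 'c) ring_scheme \<Rightarrow> ('r, 'a) module \<Rightarrow> ('r, 'l) module \<Rightarrow> ('a \<times> 'l \<Rightarrow>\<^sub>0 int) set"
  for R M L where
  add_left: "\<lbrakk>u \<in> carrier M; v \<in> carrier M; l \<in> carrier L\<rbrakk> \<Longrightarrow>
    frag_of (u \<oplus>\<^bsub>M\<^esub> v, l) - frag_of (u, l) - frag_of (v, l) \<in> tensor_relators R M L"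
| add_right: "\<lbrakk>u \<in> carrier M; l \<in> carrier L; l' \<in> carrier L\<rbrakk> \<Longrightarrow>
    frag_of (u, l \<oplus>\<^bsub>L\<^esub> l') - frag_of (u, l) - frag_of (u, l') \<in> tensor_relators R M L"
| balanced: "\<lbrakk>a \<in> carrier R; u \<in> carrier M; l \<in> carrier L\<rbrakk> \<Longrightarrow>
    frag_of (a \<odot>\<^bsub>M\<^esub> u, l) - frag_of (u, a \<odot>\<^bsub>L\<^esub> l) \<in> tensor_relators R M L"

definition tensor_kernel ::
  "('r, 'c) ring_scheme \<Rightarrow> ('r, 'a) module \<Rightarrow> ('r, 'l) module \<Rightarrow> ('a \<times> 'l \<Rightarrow>\<^sub>0 int) set" where
  "tensor_kernel R M L =
    generate (free_Abelian_group (carrier M \<times> carrier L)) (tensor_relators R M L)"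

definition tensor_product ::
  "('r, 'c) ring_scheme \<Rightarrow> ('r, 'a) module \<Rightarrow> ('r, 'l) module \<Rightarrow> ('a \<times> 'l \<Rightarrow>\<^sub>0 int) set monoid" where
  "tensor_product R M L =
    free_Abelian_group (carrier M \<times> carrier L) Mod tensor_kernel R M L"

text \<open>
  The map \<open>f \<otimes> id : N \<otimes> L \<rightarrow> M \<otimes> L\<close> sends the class of \<open>c\<close> to the class of \<open>(f \<times> id) c\<close>. All
  representatives \<open>c\<close> of a class \<open>C\<close> give the same class, so the union below is that class.
\<close>

definition tensor_map ::
  "('r, 'c) ring_scheme \<Rightarrow> ('r, 'a) module \<Rightarrow> ('r, 'l) module \<Rightarrow> ('b \<Rightarrow> 'a) \<Rightarrow>
   ('b \<times> 'l \<Rightarrow>\<^sub>0 int) set \<Rightarrow> ('a \<times> 'l \<Rightarrow>\<^sub>0 int) set" where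
  "tensor_map R M L f C =
    (\<Union>c \<in> C. tensor_kernel R M L #>\<^bsub>free_Abelian_group (carrier M \<times> carrier L)\<^esub>
       frag_extend (\<lambda>(u, l). frag_of (f u, l)) c)"

text \<open>
  HOL cannot quantify over modules on all types inside a definition, so \<open>L\<close> ranges over the modules
  whose elements are lists of scalars. Every finitely generated module is isomorphic to such an
  \<open>L\<close> (represent each element by a list of coefficients), and the lemma
  \<open>pure_submodule_universal\<close> below shows that nothing is lost: purity in this sense implies
  injectivity for modules \<open>L\<close> on any type whatsoever.
\<close>

definition pure_submodule ::
  "('r, 'c) ring_scheme \<Rightarrow> ('r, 'a) module \<Rightarrow> 'a set \<Rightarrow> bool" where
  "pure_submodule R M N \<longleftrightarrow> submodule N R M \<and>
    (\<forall>L :: ('r, 'r list) module. module R L \<longrightarrow>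
       inj_on (tensor_map R M L (\<lambda>u. u)) (carrier (tensor_product R (M\<lparr>carrier := N\<rparr>) L)))"

lemma tensor_relators_carrier:
  fixes M :: "('r, 'a) module" and L :: "('r, 'l) module"
  assumes "module R M" "module R L"
  shows "tensor_relators R M L \<subseteq> carrier (free_Abelian_group (carrier M \<times> carrier L))"
proof -
  interpret M: module R M by fact
  interpret L: module R L by fact
  have diff: "Poly_Mapping.keys (a - b) \<subseteq> A"
    if "Poly_Mapping.keys a \<subseteq> A" "Poly_Mapping.keys b \<subseteq> A"
    for a b :: "'a \<times> 'l \<Rightarrow>\<^sub>0 int" and A
    using that keys_diff[of a b] by blast
  show ?thesis
  proof
    fix c assume "c \<in> tensor_relators R M L"
    then show "c \<in> carrier (free_Abelian_group (carrier M \<times> carrier L))"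
      unfolding carrier_free_Abelian_group_iff
      by cases (simp_all add: diff)
  qed
qed

lemma tensor_kernel_subgroup:
  assumes "module R M" "module R L"
  shows "subgroup (tensor_kernel R M L) (free_Abelian_group (carrier M \<times> carrier L))"
  unfolding tensor_kernel_def
  by (intro group.generate_is_subgroup group_free_Abelian_group tensor_relators_carrier assms)

lemma tensor_kernel_closed:
  assumes "module R M" "module R L"
  shows "c \<in> tensor_kernel R M L \<Longrightarrow> Poly_Mapping.keys c \<subseteq> carrier M \<times> carrier L"
    and "0 \<in> tensor_kernel R M L"
    and "c \<in> tensor_kernel R M L \<Longrightarrow> - c \<in> tensor_kernel R M L"
    and "c \<in> tensor_kernel R M L \<Longrightarrow> d \<in> tensor_kernel R M L \<Longrightarrow> c + d \<in> tensor_kernel R M L"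
proof -
  interpret K: subgroup "tensor_kernel R M L" "free_Abelian_group (carrier M \<times> carrier L)"
    by (rule tensor_kernel_subgroup[OF assms])
  show carr: "c \<in> tensor_kernel R M L \<Longrightarrow> Poly_Mapping.keys c \<subseteq> carrier M \<times> carrier L" for c
    using K.subset[THEN subsetD, of c] by (simp only: carrier_free_Abelian_group_iff)
  show "0 \<in> tensor_kernel R M L"
    using K.one_closed by simp
  show "c \<in> tensor_kernel R M L \<Longrightarrow> - c \<in> tensor_kernel R M L"
    using K.m_inv_closed[of c] carr[of c] by simp
  show "c \<in> tensor_kernel R M L \<Longrightarrow> d \<in> tensor_kernel R M L \<Longrightarrow> c + d \<in> tensor_kernel R M L"
    using K.m_closed[of c d] by simp
qed

lemma tensor_kernel_relators: "tensor_relators R M L \<subseteq> tensor_kernel R M L"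
  by (auto simp: tensor_kernel_def intro: generate.incl)

lemma tensor_kernel_induct [consumes 3, case_names zero relator minus add]:
  assumes "module R M" "module R L" "c \<in> tensor_kernel R M L"
    and "P 0" "\<And>c. c \<in> tensor_relators R M L \<Longrightarrow> P c"
    and "\<And>c. P c \<Longrightarrow> P (- c)"
    and "\<And>c d. P c \<Longrightarrow> P d \<Longrightarrow> P (c + d)"
  shows "P c"
  using assms(3) unfolding tensor_kernel_def
proof (induction rule: generate.induct)
  case (inv h)
  have "Poly_Mapping.keys h \<subseteq> carrier M \<times> carrier L"
    using subsetD[OF tensor_relators_carrier[OF assms(1,2)] inv] by (simp only: carrier_free_Abelian_group_iff)
  then show ?case using assms(5)[OF inv] assms(6) by simp
qed (use assms in auto)

text \<open>Injectivity of \<open>N \<otimes> L \<rightarrow> M \<otimes> L\<close> in terms of representatives.\<close>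

lemma inj_on_tensor_map_iff:
  fixes M :: "('r, 'a) module" and L :: "('r, 'l) module"
  assumes M: "module R M" and L: "module R L" and N: "submodule N R M"
  shows "inj_on (tensor_map R M L (\<lambda>u. u)) (carrier (tensor_product R (M\<lparr>carrier := N\<rparr>) L)) \<longleftrightarrow>
    (\<forall>c. Poly_Mapping.keys c \<subseteq> N \<times> carrier L \<and> c \<in> tensor_kernel R M L \<longrightarrow>
       c \<in> tensor_kernel R (M\<lparr>carrier := N\<rparr>) L)" (is "?inj \<longleftrightarrow> ?ker")
proof -
  let ?N = "M\<lparr>carrier := N\<rparr>"
  let ?KN = "tensor_kernel R ?N L" and ?KM = "tensor_kernel R M L"
  let ?FN = "free_Abelian_group (N \<times> carrier L)"
  let ?FM = "free_Abelian_group (carrier M \<times> carrier L)"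
  have modN: "module R ?N"
    using submodule.submodule_is_module[OF N M] .
  have NM: "N \<subseteq> carrier M"
    using module.submoduleE(1)[OF M N] .
  note KN = tensor_kernel_closed[OF modN L] and KM = tensor_kernel_closed[OF M L]
  have sub: "?KN \<subseteq> ?KM"
  proof
    fix c assume "c \<in> ?KN"
    with modN L show "c \<in> ?KM"
    proof (induction rule: tensor_kernel_induct)
      case (relator c)
      then have "c \<in> tensor_relators R M L"
        by cases (use NM in \<open>auto intro: tensor_relators.intros\<close>)
      then show ?case using tensor_kernel_relators by blast
    qed (use KM in auto)
  qed
  have coset: "?KN #>\<^bsub>?FN\<^esub> a = (\<lambda>k. k + a) ` ?KN" "?KM #>\<^bsub>?FM\<^esub> a = (\<lambda>k. k + a) ` ?KM" for a
    by (auto simp: r_coset_def)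
  have shift: "(\<lambda>k. k + (k' + a)) ` ?KM = (\<lambda>k. k + a) ` ?KM" if "k' \<in> ?KM" for k' a
  proof (intro equalityI subsetI)
    fix z assume "z \<in> (\<lambda>k. k + a) ` ?KM"
    then obtain k where "k \<in> ?KM" "z = (k + - k') + (k' + a)" by auto
    then show "z \<in> (\<lambda>k. k + (k' + a)) ` ?KM" using KM(3,4) that by blast
  next
    fix z assume "z \<in> (\<lambda>k. k + (k' + a)) ` ?KM"
    then obtain k where "k \<in> ?KM" "z = (k + k') + a" by (auto simp: add.assoc)
    then show "z \<in> (\<lambda>k. k + a) ` ?KM" using KM(4) that by blast
  qed
  have id: "frag_extend (\<lambda>(u, l). frag_of (u, l)) c = c" for c :: "'a \<times> 'l \<Rightarrow>\<^sub>0 int"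
    using frag_extend_eq[of c "\<lambda>(u, l). frag_of (u, l)" frag_of] frag_expansion[of c] by auto
  have map: "tensor_map R M L (\<lambda>u. u) (?KN #>\<^bsub>?FN\<^esub> a) = ?KM #>\<^bsub>?FM\<^esub> a" for a
  proof -
    have "(\<Union>c\<in>(\<lambda>k. k + a) ` ?KN. (\<lambda>k. k + c) ` ?KM) = (\<Union>k\<in>?KN. (\<lambda>k. k + a) ` ?KM)"
      unfolding UN_simps by (rule SUP_cong[OF refl]) (rule shift, use sub in blast)
    also have "\<dots> = (\<lambda>k. k + a) ` ?KM" using KN(2) by blast
    finally show ?thesis unfolding tensor_map_def id coset .
  qed
  have carr: "carrier (tensor_product R ?N L) = (\<lambda>a. ?KN #>\<^bsub>?FN\<^esub> a) ` {a. Poly_Mapping.keys a \<subseteq> N \<times> carrier L}"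
    by (auto simp: tensor_product_def carrier_FactGroup)
  have eqN: "?KN #>\<^bsub>?FN\<^esub> a = ?KN #>\<^bsub>?FN\<^esub> b" if "a - b \<in> ?KN" for a b
  proof -
    have "z \<in> (\<lambda>k. k + b) ` ?KN" if "z \<in> (\<lambda>k. k + a) ` ?KN" for z
    proof -
      from that obtain k where "k \<in> ?KN" "z = (k + (a - b)) + b" by auto
      then show ?thesis using KN(4) \<open>a - b \<in> ?KN\<close> by blast
    qed
    moreover have "z \<in> (\<lambda>k. k + a) ` ?KN" if "z \<in> (\<lambda>k. k + b) ` ?KN" for z
    proof -
      from that obtain k where "k \<in> ?KN" "z = (k + - (a - b)) + a" by auto
      then show ?thesis using KN(3,4) \<open>a - b \<in> ?KN\<close> by blast
    qed
    ultimately show ?thesis unfolding coset by blast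
  qed
  have eqM: "a - b \<in> ?KM" if "?KM #>\<^bsub>?FM\<^esub> a = ?KM #>\<^bsub>?FM\<^esub> b" for a b
  proof -
    have "a \<in> (\<lambda>k. k + a) ` ?KM" using KM(2) by force
    then have "a \<in> (\<lambda>k. k + b) ` ?KM" by (simp only: that[unfolded coset])
    then obtain k where "k \<in> ?KM" "a = k + b" by blast
    then show ?thesis by simp
  qed
  show ?thesis
  proof
    assume inj: ?inj
    show ?ker
    proof (intro allI impI, elim conjE)
      fix c assume c: "Poly_Mapping.keys c \<subseteq> N \<times> carrier L" "c \<in> ?KM"
      have "?KM #>\<^bsub>?FM\<^esub> c = ?KM #>\<^bsub>?FM\<^esub> 0"
        unfolding coset using shift[OF c(2), of 0] by simp
      then have "?KN #>\<^bsub>?FN\<^esub> c = ?KN #>\<^bsub>?FN\<^esub> 0"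
        using inj_onD[OF inj, of "?KN #>\<^bsub>?FN\<^esub> c" "?KN #>\<^bsub>?FN\<^esub> 0"] c by (simp add: map carr)
      moreover have "c \<in> ?KN #>\<^bsub>?FN\<^esub> c" unfolding coset using KN(2) by force
      ultimately show "c \<in> ?KN" unfolding coset by simp
    qed
  next
    assume ker: ?ker
    show ?inj
    proof (rule inj_onI, unfold carr, clarsimp simp: map)
      fix a b assume ab: "Poly_Mapping.keys a \<subseteq> N \<times> carrier L" "Poly_Mapping.keys b \<subseteq> N \<times> carrier L"
        and eq: "?KM #>\<^bsub>?FM\<^esub> a = ?KM #>\<^bsub>?FM\<^esub> b"
      have "Poly_Mapping.keys (a - b) \<subseteq> N \<times> carrier L"
        using ab keys_diff[of a b] by blast
      then show "?KN #>\<^bsub>?FN\<^esub> a = ?KN #>\<^bsub>?FN\<^esub> b"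
        using ker eqM[OF eq] eqN by blast
    qed
  qed
qed

lemma tensor_kernel_push:
  assumes M: "module R M" and "module R L" "module R L'" and h: "h \<in> module_hom R L L'"
    and "c \<in> tensor_kernel R M L"
  shows "frag_extend (frag_of \<circ> (\<lambda>(u, l). (u, h l))) c \<in> tensor_kernel R M L'"
  using assms(1,2,5)
proof (induction rule: tensor_kernel_induct)
  case (relator c)
  have hc: "h l \<in> carrier L'" if "l \<in> carrier L" for l
    using h that by (auto simp: module_hom_def)
  from relator have "frag_extend (frag_of \<circ> (\<lambda>(u, l). (u, h l))) c \<in> tensor_relators R M L'"
    by cases (use h hc in \<open>auto simp: frag_extend_diff module_hom_def intro: tensor_relators.intros\<close>)
  then show ?case using tensor_kernel_relators by blast
qed (use tensor_kernel_closed[OF assms(1,3)] in \<open>auto simp: frag_extend_minus frag_extend_add\<close>)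

lemma tensor_kernel_finite:
  assumes M: "module R M" and L: "module R L" and "c \<in> tensor_kernel R M L"
  shows "\<exists>A. finite A \<and> A \<subseteq> carrier L \<and>
    (\<forall>L'. submodule L' R L \<and> A \<subseteq> L' \<longrightarrow> c \<in> tensor_kernel R M (L\<lparr>carrier := L'\<rparr>))"
  using assms
proof (induction rule: tensor_kernel_induct)
  case zero
  show ?case
    using tensor_kernel_closed(2)[OF M submodule.submodule_is_module[OF _ L]] by blast
next
  case (relator c)
  then show ?case
  proof cases
    case (add_left u v l)
    then show ?thesis
      by (intro exI[of _ "{l}"])
        (auto intro!: subsetD[OF tensor_kernel_relators] tensor_relators.add_left)
  next
    case (add_right u l l')
    have "frag_of (u, l \<oplus>\<^bsub>L\<^esub> l') - frag_of (u, l) - frag_of (u, l')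
        \<in> tensor_relators R M (L\<lparr>carrier := L'\<rparr>)" if "{l, l'} \<subseteq> L'" for L'
      using tensor_relators.add_right[of u M l "L\<lparr>carrier := L'\<rparr>" l' R] add_right that by simp
    with add_right show ?thesis
      by (intro exI[of _ "{l, l'}"]) (auto intro!: subsetD[OF tensor_kernel_relators])
  next
    case (balanced a u l)
    have "frag_of (a \<odot>\<^bsub>M\<^esub> u, l) - frag_of (u, a \<odot>\<^bsub>L\<^esub> l)
        \<in> tensor_relators R M (L\<lparr>carrier := L'\<rparr>)" if "{l} \<subseteq> L'" for L'
      using tensor_relators.balanced[of a R u M l "L\<lparr>carrier := L'\<rparr>"] balanced that by simp
    with balanced show ?thesis
      by (intro exI[of _ "{l}"]) (auto intro!: subsetD[OF tensor_kernel_relators])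
  qed
next
  case (minus c)
  then show ?case
    by (elim exE conjE, intro exI conjI allI impI)
      (assumption | simp add: tensor_kernel_closed(3)[OF M submodule.submodule_is_module[OF _ L]])+
next
  case (add c d)
  then obtain A B where "finite A" "A \<subseteq> carrier L" "finite B" "B \<subseteq> carrier L"
    "\<forall>L'. submodule L' R L \<and> A \<subseteq> L' \<longrightarrow> c \<in> tensor_kernel R M (L\<lparr>carrier := L'\<rparr>)"
    "\<forall>L'. submodule L' R L \<and> B \<subseteq> L' \<longrightarrow> d \<in> tensor_kernel R M (L\<lparr>carrier := L'\<rparr>)"
    by (elim exE conjE)
  then show ?case
    by (intro exI[of _ "A \<union> B"] conjI allI impI)
      (simp_all add: tensor_kernel_closed(4)[OF M submodule.submodule_is_module[OF _ L]])
qed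

lemma finite_subset_submodule_list:
  fixes L :: "('r, 'l) module"
  assumes L: "module R L" and "finite A" "A \<subseteq> carrier L"
  shows "\<exists>L' (g :: 'l \<Rightarrow> 'r list). submodule L' R L \<and> A \<subseteq> L' \<and> inj_on g L'"
  using assms(2,3)
proof (induction rule: finite_induct)
  case empty
  interpret L: module R L by fact
  have "submodule {\<zero>\<^bsub>L\<^esub>} R L"
    by (rule L.submoduleI) auto
  then show ?case by (intro exI[of _ "{\<zero>\<^bsub>L\<^esub>}"]) auto
next
  case (insert w A)
  interpret L: module R L by fact
  from insert obtain N and g :: "'l \<Rightarrow> 'r list" where N: "submodule N R L" "A \<subseteq> N" "inj_on g N"
    by auto
  have w: "w \<in> carrier L" using insert by simp
  note NE = L.submoduleE[OF N(1)]
  have zN: "\<zero>\<^bsub>L\<^esub> \<in> N"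
    using submodule.axioms(1)[OF N(1)] subgroup.one_closed by fastforce
  have Nc: "v \<in> carrier L" if "v \<in> N" for v using that NE(1) by blast
  let ?N = "{a \<odot>\<^bsub>L\<^esub> w \<oplus>\<^bsub>L\<^esub> v | a v. a \<in> carrier R \<and> v \<in> N}"
  have sub: "submodule ?N R L"
  proof (rule L.submoduleI)
    show "?N \<subseteq> carrier L" using w Nc by auto
    show "\<zero>\<^bsub>L\<^esub> \<in> ?N"
      using zN w by (intro CollectI exI[of _ "\<zero>\<^bsub>R\<^esub>"] exI[of _ "\<zero>\<^bsub>L\<^esub>"]) auto
    show "\<ominus>\<^bsub>L\<^esub> z \<in> ?N" if z: "z \<in> ?N" for z
    proof -
      from z obtain a v where "a \<in> carrier R" "v \<in> N" "z = a \<odot>\<^bsub>L\<^esub> w \<oplus>\<^bsub>L\<^esub> v" by auto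
      then show ?thesis
        using w Nc NE(3)
        by (intro CollectI exI[of _ "\<ominus>\<^bsub>R\<^esub> a"] exI[of _ "\<ominus>\<^bsub>L\<^esub> v"])
          (auto simp: L.smult_l_minus L.minus_add)
    qed
    show "z \<oplus>\<^bsub>L\<^esub> z' \<in> ?N" if z: "z \<in> ?N" and z': "z' \<in> ?N" for z z'
    proof -
      from z obtain a v where "a \<in> carrier R" "v \<in> N" "z = a \<odot>\<^bsub>L\<^esub> w \<oplus>\<^bsub>L\<^esub> v" by auto
      moreover from z' obtain a' v' where "a' \<in> carrier R" "v' \<in> N" "z' = a' \<odot>\<^bsub>L\<^esub> w \<oplus>\<^bsub>L\<^esub> v'" by auto
      ultimately show ?thesis
        using w Nc NE(5)
        by (intro CollectI exI[of _ "a \<oplus>\<^bsub>R\<^esub> a'"] exI[of _ "v \<oplus>\<^bsub>L\<^esub> v'"])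
          (auto simp: L.smult_l_distr L.M.add.m_ac)
    qed
    show "b \<odot>\<^bsub>L\<^esub> z \<in> ?N" if b: "b \<in> carrier R" and z: "z \<in> ?N" for b z
    proof -
      from z obtain a v where "a \<in> carrier R" "v \<in> N" "z = a \<odot>\<^bsub>L\<^esub> w \<oplus>\<^bsub>L\<^esub> v" by auto
      then show ?thesis
        using w Nc NE(4) b
        by (intro CollectI exI[of _ "b \<otimes>\<^bsub>R\<^esub> a"] exI[of _ "b \<odot>\<^bsub>L\<^esub> v"])
          (auto simp: L.smult_r_distr L.smult_assoc1)
    qed
  qed
  define pr where "pr z = (SOME p. fst p \<in> carrier R \<and> snd p \<in> N \<and> z = fst p \<odot>\<^bsub>L\<^esub> w \<oplus>\<^bsub>L\<^esub> snd p)" for z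
  have pr: "fst (pr z) \<in> carrier R \<and> snd (pr z) \<in> N \<and> z = fst (pr z) \<odot>\<^bsub>L\<^esub> w \<oplus>\<^bsub>L\<^esub> snd (pr z)"
    if "z \<in> ?N" for z
  proof -
    from that obtain a v where "a \<in> carrier R" "v \<in> N" "z = a \<odot>\<^bsub>L\<^esub> w \<oplus>\<^bsub>L\<^esub> v" by auto
    then have "\<exists>p. fst p \<in> carrier R \<and> snd p \<in> N \<and> z = fst p \<odot>\<^bsub>L\<^esub> w \<oplus>\<^bsub>L\<^esub> snd p"
      by (intro exI[of _ "(a, v)"]) simp
    then show ?thesis unfolding pr_def by (rule someI_ex)
  qed
  have "inj_on (\<lambda>z. fst (pr z) # g (snd (pr z))) ?N"
  proof (rule inj_onI)
    fix z z' assume zz: "z \<in> ?N" "z' \<in> ?N"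
      and eq: "fst (pr z) # g (snd (pr z)) = fst (pr z') # g (snd (pr z'))"
    then have "snd (pr z) = snd (pr z')"
      using pr[OF zz(1)] pr[OF zz(2)] inj_onD[OF N(3)] by simp
    moreover have "fst (pr z) = fst (pr z')" using eq by simp
    ultimately show "z = z'"
      using pr[OF zz(1), THEN conjunct2, THEN conjunct2] pr[OF zz(2), THEN conjunct2, THEN conjunct2]
      by (metis (no_types))
  qed
  moreover have "insert w A \<subseteq> ?N"
  proof -
    have "w \<in> ?N"
      using zN w by (intro CollectI exI[of _ "\<one>\<^bsub>R\<^esub>"] exI[of _ "\<zero>\<^bsub>L\<^esub>"]) simp
    moreover have "v \<in> ?N" if "v \<in> A" for v
    proof -
      have "v \<in> N" using that N(2) by blast
      then show ?thesis
        using w Nc[of v] by (intro CollectI exI[of _ "\<zero>\<^bsub>R\<^esub>"] exI[of _ v]) simp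
    qed
    ultimately show ?thesis by blast
  qed
  ultimately show ?case using sub by blast
qed

lemma module_transport:
  fixes L :: "('r, 'l) module" and g :: "'l \<Rightarrow> 't"
  assumes L: "module R L" and g: "inj_on g (carrier L)"
  obtains T :: "('r, 't) module" and h where "module R T" "carrier T = g ` carrier L"
    "g \<in> module_hom R L T" "h \<in> module_hom R T L" "\<And>l. l \<in> carrier L \<Longrightarrow> h (g l) = l"
proof -
  interpret L: module R L by fact
  define h where "h = inv_into (carrier L) g"
  have hg [simp]: "h (g l) = l" if "l \<in> carrier L" for l
    using that g by (simp add: h_def)
  define T :: "('r, 't) module" where
    "T = \<lparr>carrier = g ` carrier L, monoid.mult = undefined, one = undefined, ring.zero = g \<zero>\<^bsub>L\<^esub>,
          ring.add = (\<lambda>s t. g (h s \<oplus>\<^bsub>L\<^esub> h t)), smult = (\<lambda>a t. g (a \<odot>\<^bsub>L\<^esub> h t))\<rparr>"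
  have "module R T"
  proof (rule moduleI)
    show "abelian_group T"
    proof (rule abelian_groupI)
      show "\<exists>t\<in>carrier T. t \<oplus>\<^bsub>T\<^esub> s = \<zero>\<^bsub>T\<^esub>" if s: "s \<in> carrier T" for s
      proof -
        from s obtain l where l: "l \<in> carrier L" "s = g l" by (auto simp: T_def)
        then show ?thesis
          by (intro bexI[of _ "g (\<ominus>\<^bsub>L\<^esub> l)"]) (auto simp: T_def L.l_neg)
      qed
    qed (auto simp: T_def L.M.add.m_ac)
  qed (auto simp: T_def L.is_cring L.smult_l_distr L.smult_r_distr L.smult_assoc1)
  moreover have "g \<in> module_hom R L T" "h \<in> module_hom R T L"
    by (auto simp: module_hom_def T_def)
  moreover have "carrier T = g ` carrier L" by (simp add: T_def)
  ultimately show thesis using that hg by blast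
qed

lemma pure_submodule_universal:
  fixes M :: "('r, 'a) module" and L :: "('r, 'l) module"
  assumes M: "module R M" and L: "module R L" and pure: "pure_submodule R M N"
  shows "inj_on (tensor_map R M L (\<lambda>u. u)) (carrier (tensor_product R (M\<lparr>carrier := N\<rparr>) L))"
proof -
  have N: "submodule N R M" using pure by (simp add: pure_submodule_def)
  have modN: "module R (M\<lparr>carrier := N\<rparr>)" using submodule.submodule_is_module[OF N M] .
  have "c \<in> tensor_kernel R (M\<lparr>carrier := N\<rparr>) L"
    if c: "Poly_Mapping.keys c \<subseteq> N \<times> carrier L" "c \<in> tensor_kernel R M L" for c
  proof -
    obtain A where A: "finite A" "A \<subseteq> carrier L"
      "\<And>L'. submodule L' R L \<Longrightarrow> A \<subseteq> L' \<Longrightarrow> c \<in> tensor_kernel R M (L\<lparr>carrier := L'\<rparr>)"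
      using tensor_kernel_finite[OF M L c(2)] by blast
    have "finite (A \<union> snd ` Poly_Mapping.keys c)" "A \<union> snd ` Poly_Mapping.keys c \<subseteq> carrier L"
      using A c by auto
    from finite_subset_submodule_list[OF L this]
    obtain L' and g :: "'l \<Rightarrow> 'r list"
      where L': "submodule L' R L" "A \<union> snd ` Poly_Mapping.keys c \<subseteq> L'" and g: "inj_on g L'"
      by auto
    let ?L' = "L\<lparr>carrier := L'\<rparr>"
    have modL': "module R ?L'" using submodule.submodule_is_module[OF L'(1) L] .
    obtain T :: "('r, 'r list) module" and h where T: "module R T" "carrier T = g ` L'"
      "g \<in> module_hom R ?L' T" "h \<in> module_hom R T ?L'" "\<And>l. l \<in> L' \<Longrightarrow> h (g l) = l"
      by (rule module_transport[OF modL', of g]) (use g in auto)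
    have incl: "(\<lambda>l. l) \<in> module_hom R ?L' L"
      using module.submoduleE(1)[OF L L'(1)] by (auto simp: module_hom_def)
    let ?push = "\<lambda>f. frag_extend (frag_of \<circ> (\<lambda>(u, l). (u, f l)))"
    have "c \<in> tensor_kernel R M ?L'" using A(3) L' by simp
    then have "?push g c \<in> tensor_kernel R M T"
      by (rule tensor_kernel_push[OF M modL' T(1) T(3)])
    moreover have "Poly_Mapping.keys (?push g c) \<subseteq> N \<times> carrier T"
    proof (rule order_trans[OF keys_frag_extend])
      show "(\<Union>z\<in>Poly_Mapping.keys c. Poly_Mapping.keys ((frag_of \<circ> (\<lambda>(u, l). (u, g l))) z)) \<subseteq> N \<times> carrier T"
        using c(1) L'(2) T(2) by force
    qed
    ultimately have "?push g c \<in> tensor_kernel R (M\<lparr>carrier := N\<rparr>) T"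
      using pure T(1) inj_on_tensor_map_iff[OF M T(1) N] by (simp add: pure_submodule_def)
    then have "?push h (?push g c) \<in> tensor_kernel R (M\<lparr>carrier := N\<rparr>) ?L'"
      by (rule tensor_kernel_push[OF modN T(1) modL' T(4)])
    then have "?push (\<lambda>l. l) (?push h (?push g c)) \<in> tensor_kernel R (M\<lparr>carrier := N\<rparr>) L"
      by (rule tensor_kernel_push[OF modN modL' L incl])
    also have "?push (\<lambda>l. l) (?push h (?push g c)) = frag_extend frag_of c"
      unfolding frag_extend_compose o_assoc[symmetric]
      by (rule frag_extend_eq) (use L'(2) T(5) in force)
    also have "\<dots> = c" using frag_expansion[of c] by simp
    finally show ?thesis .
  qed
  then show ?thesis using inj_on_tensor_map_iff[OF M L N] by blast
qed

section \<open>Local cohomology\<close>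

text \<open>
  By Baer's criterion it suffices to test injectivity on the ideals of \<open>R\<close>, so the modules \<open>B\<close> on
  lists of scalars (among them a copy of \<open>R\<close>) decide injectivity with respect to all modules.
\<close>

definition injective_module :: "('r, 'c) ring_scheme \<Rightarrow> ('r, 'a) module \<Rightarrow> bool" where
  "injective_module R E \<longleftrightarrow> module R E \<and>
    (\<forall>(B :: ('r, 'r list) module) A f.
       module R B \<and> submodule A R B \<and> f \<in> module_hom R (B\<lparr>carrier := A\<rparr>) E \<longrightarrow>
       (\<exists>g \<in> module_hom R B E. \<forall>a \<in> A. g a = f a))"

definition injective_resolution ::
  "('r, 'c) ring_scheme \<Rightarrow> ('r, 'a) module \<Rightarrow> (nat \<Rightarrow> ('r, 'u) module) \<Rightarrow> ('a \<Rightarrow> 'u) \<Rightarrow>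
   (nat \<Rightarrow> 'u \<Rightarrow> 'u) \<Rightarrow> bool" where
  "injective_resolution R M E \<epsilon> \<delta> \<longleftrightarrow>
     (\<forall>i. injective_module R (E i)) \<and>
     \<epsilon> \<in> module_hom R M (E 0) \<and> inj_on \<epsilon> (carrier M) \<and>
     (\<forall>i. \<delta> i \<in> module_hom R (E i) (E (Suc i))) \<and>
     \<epsilon> ` carrier M = {z \<in> carrier (E 0). \<delta> 0 z = \<zero>\<^bsub>E 1\<^esub>} \<and>
     (\<forall>i. \<delta> i ` carrier (E i) = {z \<in> carrier (E (Suc i)). \<delta> (Suc i) z = \<zero>\<^bsub>E (Suc (Suc i))\<^esub>})"

definition ideal_power :: "('r, 'c) ring_scheme \<Rightarrow> 'r set \<Rightarrow> nat \<Rightarrow> 'r set" where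
  "ideal_power R J k = (ideal_prod R J ^^ k) (carrier R)"

definition torsion :: "('r, 'c) ring_scheme \<Rightarrow> 'r set \<Rightarrow> ('r, 'a) module \<Rightarrow> 'a set" where
  "torsion R J M = {u \<in> carrier M. \<exists>k. \<forall>a \<in> ideal_power R J k. a \<odot>\<^bsub>M\<^esub> u = \<zero>\<^bsub>M\<^esub>}"

text \<open>
  The cocycles and coboundaries of the complex \<open>\<Gamma>\<^sub>J(E\<^sup>0) \<rightarrow> \<Gamma>\<^sub>J(E\<^sup>1) \<rightarrow> \<dots>\<close>, whose \<open>i\<close>-th cohomology is
  \<open>H\<^sup>i\<^sub>J(M) = R\<^sup>i\<Gamma>\<^sub>J(M)\<close>.
\<close>

definition lc_cocycles ::
  "('r, 'c) ring_scheme \<Rightarrow> 'r set \<Rightarrow> (nat \<Rightarrow> ('r, 'u) module) \<Rightarrow> (nat \<Rightarrow> 'u \<Rightarrow> 'u) \<Rightarrow> nat \<Rightarrow> 'u set" where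
  "lc_cocycles R J E \<delta> i = {z \<in> torsion R J (E i). \<delta> i z = \<zero>\<^bsub>E (Suc i)\<^esub>}"

definition lc_coboundaries ::
  "('r, 'c) ring_scheme \<Rightarrow> 'r set \<Rightarrow> (nat \<Rightarrow> ('r, 'u) module) \<Rightarrow> (nat \<Rightarrow> 'u \<Rightarrow> 'u) \<Rightarrow> nat \<Rightarrow> 'u set" where
  "lc_coboundaries R J E \<delta> i =
    (case i of 0 \<Rightarrow> {\<zero>\<^bsub>E 0\<^esub>} | Suc j \<Rightarrow> \<delta> j ` torsion R J (E j))"

text \<open>
  \<open>H\<^sup>i\<^sub>J(M) \<noteq> 0\<close>. The isomorphism type of the cohomology does not depend on the resolution. The type
  \<^typ>\<open>('r \<times> 'a) set\<close> is large enough to contain an injective resolution whenever \<^typ>\<open>'r\<close> is infinite: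
  if \<open>\<kappa>\<close> is the cardinality of \<^typ>\<open>'r \<times> 'a\<close>, a module \<open>X\<close> with at most \<open>2\<^sup>\<kappa>\<close> elements embeds as an
  abelian group into a divisible group \<open>D\<close> with at most \<open>2\<^sup>\<kappa>\<close> elements, hence as a module into the
  injective module \<open>Hom(R, D)\<close> of additive maps, which again has at most \<open>(2\<^sup>\<kappa>)\<^sup>\<kappa> = 2\<^sup>\<kappa>\<close> elements; iterate on cokernels.
\<close>

definition local_cohomology_nonzero ::
  "('r, 'c) ring_scheme \<Rightarrow> 'r set \<Rightarrow> ('r, 'a) module \<Rightarrow> nat \<Rightarrow> bool" where
  "local_cohomology_nonzero R J M i \<longleftrightarrow>
    (\<exists>(E :: nat \<Rightarrow> ('r, ('r \<times> 'a) set) module) \<epsilon> \<delta>.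
       injective_resolution R M E \<epsilon> \<delta> \<and> lc_cocycles R J E \<delta> i \<noteq> lc_coboundaries R J E \<delta> i)"

text \<open>
  Least and largest \<open>i\<close> with \<open>H\<^sup>i\<^sub>J(M) \<noteq> 0\<close>. Both exist when \<open>M\<close> is finitely generated over a Noetherian
  ring and \<open>JM \<noteq> M\<close>; otherwise the values carry no meaning.
\<close>

definition grade :: "('r, 'c) ring_scheme \<Rightarrow> 'r set \<Rightarrow> ('r, 'a) module \<Rightarrow> nat" where
  "grade R J M = (LEAST i. local_cohomology_nonzero R J M i)"

definition cd :: "('r, 'c) ring_scheme \<Rightarrow> 'r set \<Rightarrow> ('r, 'a) module \<Rightarrow> nat" where
  "cd R J M = (GREATEST i. local_cohomology_nonzero R J M i)"

definition relative_CM :: "('r, 'c) ring_scheme \<Rightarrow> 'r set \<Rightarrow> ('r, 'a) module \<Rightarrow> bool" where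
  "relative_CM R J M \<longleftrightarrow> grade R J M = cd R J M"

section \<open>Associated primes, dimension and unmixedness\<close>

definition Ass :: "('r, 'c) ring_scheme \<Rightarrow> ('r, 'a) module \<Rightarrow> 'r set set" where
  "Ass R M = {p. primeideal p R \<and> (\<exists>u \<in> carrier M. p = elem_annihilator R M u)}"

definition relative_unmixed :: "('r, 'c) ring_scheme \<Rightarrow> 'r set \<Rightarrow> ('r, 'a) module \<Rightarrow> bool" where
  "relative_unmixed R J M \<longleftrightarrow> (\<forall>p \<in> Ass R M. cd R J M = cd R J (quotient_module R p))"

text \<open>The supremum in \<^typ>\<open>enat\<close> gives the zero ring dimension 0; it is only used for nonzero rings.\<close>

definition krull_dim :: "('r, 'c) ring_scheme \<Rightarrow> enat" where
  "krull_dim R = Sup {enat l | l. \<exists>c :: nat \<Rightarrow> 'r set.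
     (\<forall>i \<le> l. primeideal (c i) R) \<and> (\<forall>i < l. c i \<subset> c (Suc i))}"

definition module_dim :: "('r, 'c) ring_scheme \<Rightarrow> ('r, 'a) module \<Rightarrow> enat" where
  "module_dim R M = krull_dim (R Quot annihilator R M)"

definition unmixed :: "('r, 'c) ring_scheme \<Rightarrow> ('r, 'a) module \<Rightarrow> bool" where
  "unmixed R M \<longleftrightarrow> (\<forall>p \<in> Ass R M. krull_dim (R Quot p) = module_dim R M)"

end

theory Submission
  imports Defs
begin

text \<open>
  Purity of all cyclic submodules makes \<open>M\<close> a von Neumann regular module, and a grading leaves no
  room for such a module except one on which all variables act as zero.

  Let \<open>f \<in> S\<close> and \<open>u \<in> M\<close>. Tensoring the inclusion of a pure submodule \<open>N\<close> into \<open>M\<close> with \<open>S/fS\<close>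
  shows \<open>N \<inter> fM = fN\<close>. For \<open>N = Sfu\<close> the element \<open>fu\<close> lies in \<open>N \<inter> fM\<close>, so \<open>fu = a f\<^sup>2 u\<close> for some
  \<open>a \<in> S\<close> (\<open>pure_cyclic_regular\<close>). Now take \<open>f\<close> to be a variable and \<open>u\<close> homogeneous. The left-hand
  side is homogeneous of degree \<open>deg f + deg u\<close>. All degrees of elements of \<open>S\<close> are nonnegative, so
  each homogeneous component of the right-hand side has a degree \<open>\<ge> 2 deg f + deg u\<close>, which exceeds
  \<open>deg f + deg u\<close> in the first or in the second coordinate. Hence \<open>fu = 0\<close>, and since \<open>M\<close> is spanned
  by homogeneous elements, every variable annihilates \<open>M\<close> (\<open>variable_annihilates\<close>).

  Thus \<open>S\<close> acts on \<open>M\<close> through the constant term, the annihilator of every nonzero element is the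
  ideal of polynomials without constant term (\<open>elem_annihilator_eq_irrelevant\<close>), and so is the
  annihilator of \<open>M\<close>. For an associated prime \<open>\<pp>\<close> the rings \<open>S/\<pp>\<close> and \<open>S/Ann M\<close> are therefore equal,
  and so are their dimensions.
\<close>

section \<open>Purity and von Neumann regularity\<close>

text \<open>
  The universal property of \<open>M \<otimes> L\<close>, in terms of representatives: a balanced biadditive map extends
  to the free abelian group on pairs and vanishes on the relations. Nonzero
  values of such a map detect nonzero tensors.
\<close>

lemma tensor_kernel_universal:
  fixes M :: "('r, 'a) module" and L :: "('r, 'l) module" and A (structure)
  assumes M: "module R M" and L: "module R L" and A: "comm_group A"
    and closed: "\<And>u l. u \<in> carrier M \<Longrightarrow> l \<in> carrier L \<Longrightarrow> \<phi> u l \<in> carrier A"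
    and add_left: "\<And>u v l. u \<in> carrier M \<Longrightarrow> v \<in> carrier M \<Longrightarrow> l \<in> carrier L \<Longrightarrow>
      \<phi> (u \<oplus>\<^bsub>M\<^esub> v) l = \<phi> u l \<otimes> \<phi> v l"
    and add_right: "\<And>u l l'. u \<in> carrier M \<Longrightarrow> l \<in> carrier L \<Longrightarrow> l' \<in> carrier L \<Longrightarrow>
      \<phi> u (l \<oplus>\<^bsub>L\<^esub> l') = \<phi> u l \<otimes> \<phi> u l'"
    and balanced: "\<And>a u l. a \<in> carrier R \<Longrightarrow> u \<in> carrier M \<Longrightarrow> l \<in> carrier L \<Longrightarrow>
      \<phi> (a \<odot>\<^bsub>M\<^esub> u) l = \<phi> u (a \<odot>\<^bsub>L\<^esub> l)"
  obtains h where "\<And>u l. u \<in> carrier M \<Longrightarrow> l \<in> carrier L \<Longrightarrow> h (frag_of (u, l)) = \<phi> u l"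
    and "\<And>c. c \<in> tensor_kernel R M L \<Longrightarrow> h c = \<one>"
proof -
  interpret M: module R M by fact
  interpret L: module R L by fact
  interpret A: comm_group A by fact
  let ?F = "free_Abelian_group (carrier M \<times> carrier L)"
  have "(\<lambda>(u, l). \<phi> u l) ` (carrier M \<times> carrier L) \<subseteq> carrier A"
    using closed by auto
  from A.free_Abelian_group_universal[OF this] obtain h where h: "h \<in> hom ?F A"
    and "\<And>z. z \<in> carrier M \<times> carrier L \<Longrightarrow> h (frag_of z) = (\<lambda>(u, l). \<phi> u l) z"
    by blast
  then have h_of: "\<And>u l. u \<in> carrier M \<Longrightarrow> l \<in> carrier L \<Longrightarrow> h (frag_of (u, l)) = \<phi> u l"
    by auto
  interpret H: group_hom ?F A h
    using h by (simp add: group_hom_def group_hom_axioms_def)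
  have h_diff: "h (a - b) = h a \<otimes> inv h b" if "a \<in> carrier ?F" "b \<in> carrier ?F" for a b
    using H.hom_mult[of a "- b"] H.hom_inv[of b] that by simp
  have diff: "a - b \<in> carrier ?F" if "a \<in> carrier ?F" "b \<in> carrier ?F" for a b
    using H.subgroup_self that keys_diff[of a b] by auto
  have of: "frag_of (u, l) \<in> carrier ?F" if "u \<in> carrier M" "l \<in> carrier L" for u l
    using that by simp
  have comm: "a \<otimes> b \<otimes> inv a \<otimes> inv b = \<one>" if "a \<in> carrier A" "b \<in> carrier A" for a b
    using that by (simp add: A.m_comm[of a b] A.m_assoc)
  have "tensor_relators R M L \<subseteq> kernel ?F A h"
  proof
    fix c assume c: "c \<in> tensor_relators R M L"
    then have "c \<in> carrier ?F" using tensor_relators_carrier[OF M L] by blast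
    moreover from c have "h c = \<one>"
      by cases (simp_all add: h_diff h_of diff of add_left add_right balanced closed comm
          del: carrier_free_Abelian_group_iff)
    ultimately show "c \<in> kernel ?F A h" by (simp add: kernel_def)
  qed
  then have "tensor_kernel R M L \<subseteq> kernel ?F A h"
    unfolding tensor_kernel_def by (rule H.generate_subgroup_incl[OF _ H.subgroup_kernel])
  then have "\<And>c. c \<in> tensor_kernel R M L \<Longrightarrow> h c = \<one>" unfolding kernel_def by blast
  with h_of show thesis by (rule that)
qed

text \<open>
  The map \<open>M \<otimes> R/fR \<rightarrow> M/fM\<close> given by \<open>u \<otimes> (s + fR) \<mapsto> su + fM\<close> is well defined and sends
  \<open>x \<otimes> 1\<close> to the class of \<open>x\<close>.
\<close>

lemma tensor_kernel_principal:
  fixes M :: "('r, 'a) module" and R (structure)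
  assumes M: "module R M" and f: "f \<in> carrier R" and x: "x \<in> carrier M"
    and ker: "frag_of (x, PIdl f +> \<one>) \<in> tensor_kernel R M (quotient_module R (PIdl f))"
  shows "\<exists>w \<in> carrier M. x = f \<odot>\<^bsub>M\<^esub> w"
proof -
  interpret M: module R M by fact
  let ?I = "PIdl f" let ?L = "quotient_module R ?I"
  interpret I: ideal ?I R using M.cgenideal_ideal[OF f] .
  have L: "module R ?L" using quotient_module_module[OF M.is_cring I.is_ideal] .
  define B where "B = {f \<odot>\<^bsub>M\<^esub> w | w. w \<in> carrier M}"
  have B_sub: "subgroup B (add_monoid M)"
  proof (rule M.add.subgroupI)
    show "B \<subseteq> carrier M" using f by (auto simp: B_def)
    show "B \<noteq> {}" using M.M.zero_closed by (auto simp: B_def)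
    show "\<ominus>\<^bsub>M\<^esub> a \<in> B" if "a \<in> B" for a
      using that M.smult_r_minus[OF f, symmetric] by (auto simp: B_def)
    show "a \<oplus>\<^bsub>M\<^esub> b \<in> B" if "a \<in> B" "b \<in> B" for a b
      using that M.smult_r_distr[OF f, symmetric] M.M.a_closed by (auto simp: B_def)
  qed
  interpret B: abelian_subgroup B M
    using B_sub by (intro abelian_subgroupI3 additive_subgroup.intro M.abelian_group_axioms)
  let ?A = "M A_Mod B"
  interpret A: comm_group ?A by (rule B.a_factorgroup_is_comm_group)
  have hom: "B +>\<^bsub>M\<^esub> (u \<oplus>\<^bsub>M\<^esub> v) = (B +>\<^bsub>M\<^esub> u) \<otimes>\<^bsub>?A\<^esub> (B +>\<^bsub>M\<^esub> v)"
    if "u \<in> carrier M" "v \<in> carrier M" for u v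
    using B.a_r_coset_hom_A_Mod that by (simp add: hom_def)
  have cl: "B +>\<^bsub>M\<^esub> u \<in> carrier ?A" if "u \<in> carrier M" for u
    using B.a_r_coset_hom_A_Mod that by (auto simp: hom_def)
  have absorb: "B +>\<^bsub>M\<^esub> (b \<oplus>\<^bsub>M\<^esub> u) = B +>\<^bsub>M\<^esub> u" if "b \<in> B" "u \<in> carrier M" for b u
    using that M.a_coset_join2[OF _ B_sub] M.a_coset_add_assoc[of B b u] B.a_subset by auto
  \<comment> \<open>The balanced map is defined on cosets through a representative; the next fact frees it of
    that choice, because two representatives differ by a multiple of \<open>f\<close>.\<close>
  define rep where "rep C = (SOME s. s \<in> carrier R \<and> C = ?I +> s)" for C
  define \<phi> where "\<phi> u C = B +>\<^bsub>M\<^esub> (rep C \<odot>\<^bsub>M\<^esub> u)" for u C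
  have \<phi>: "\<phi> u (?I +> s) = B +>\<^bsub>M\<^esub> (s \<odot>\<^bsub>M\<^esub> u)" if s: "s \<in> carrier R" and u: "u \<in> carrier M" for s u
  proof -
    let ?r = "rep (?I +> s)"
    have r: "?r \<in> carrier R" "?I +> s = ?I +> ?r"
      using someI[of "\<lambda>r. r \<in> carrier R \<and> ?I +> s = ?I +> r" s] s unfolding rep_def by auto
    have "?r \<in> ?I +> s" using I.a_rcos_self[OF r(1)] unfolding r(2)[symmetric] .
    then obtain a where a: "a \<in> carrier R" "?r = a \<otimes> f \<oplus> s"
      unfolding a_r_coset_def' cgenideal_def by blast
    have "?r \<odot>\<^bsub>M\<^esub> u = (a \<otimes> f) \<odot>\<^bsub>M\<^esub> u \<oplus>\<^bsub>M\<^esub> s \<odot>\<^bsub>M\<^esub> u"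
      unfolding a(2) using a(1) s u f by (intro M.smult_l_distr) simp_all
    also have "(a \<otimes> f) \<odot>\<^bsub>M\<^esub> u = f \<odot>\<^bsub>M\<^esub> (a \<odot>\<^bsub>M\<^esub> u)"
      using M.smult_assoc1[OF f a(1) u] M.m_comm[OF a(1) f] by simp
    finally have "?r \<odot>\<^bsub>M\<^esub> u = f \<odot>\<^bsub>M\<^esub> (a \<odot>\<^bsub>M\<^esub> u) \<oplus>\<^bsub>M\<^esub> s \<odot>\<^bsub>M\<^esub> u" .
    moreover have "f \<odot>\<^bsub>M\<^esub> (a \<odot>\<^bsub>M\<^esub> u) \<in> B" using a(1) u unfolding B_def by blast
    ultimately show ?thesis
      unfolding \<phi>_def using absorb[of "f \<odot>\<^bsub>M\<^esub> (a \<odot>\<^bsub>M\<^esub> u)" "s \<odot>\<^bsub>M\<^esub> u"] s u by simp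
  qed
  have L_carr: "\<exists>s \<in> carrier R. C = ?I +> s" if "C \<in> carrier ?L" for C
    using that by (auto simp: quotient_module_def FactRing_def A_RCOSETS_def')
  have L_ops: "(?I +> s) \<oplus>\<^bsub>?L\<^esub> (?I +> t) = ?I +> (s \<oplus> t)" "s \<odot>\<^bsub>?L\<^esub> (?I +> t) = ?I +> (s \<otimes> t)"
    if "s \<in> carrier R" "t \<in> carrier R" for s t
    using that ring_hom_add[OF I.rcos_ring_hom] ring_hom_mult[OF I.rcos_ring_hom]
    by (simp_all add: quotient_module_def)
  obtain h where h: "\<And>u l. u \<in> carrier M \<Longrightarrow> l \<in> carrier ?L \<Longrightarrow> h (frag_of (u, l)) = \<phi> u l"
    and h_ker: "\<And>c. c \<in> tensor_kernel R M ?L \<Longrightarrow> h c = \<one>\<^bsub>?A\<^esub>"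
  proof (rule tensor_kernel_universal[OF M L A.comm_group_axioms])
    show "\<phi> u l \<in> carrier ?A" if "u \<in> carrier M" "l \<in> carrier ?L" for u l
      using L_carr[OF that(2)] that by (auto simp: \<phi> cl)
    show "\<phi> (u \<oplus>\<^bsub>M\<^esub> v) l = \<phi> u l \<otimes>\<^bsub>?A\<^esub> \<phi> v l"
      if "u \<in> carrier M" "v \<in> carrier M" "l \<in> carrier ?L" for u v l
      using L_carr[OF that(3)] that by (auto simp: \<phi> hom M.smult_r_distr)
    show "\<phi> u (l \<oplus>\<^bsub>?L\<^esub> l') = \<phi> u l \<otimes>\<^bsub>?A\<^esub> \<phi> u l'"
      if "u \<in> carrier M" "l \<in> carrier ?L" "l' \<in> carrier ?L" for u l l'
      using L_carr[OF that(2)] L_carr[OF that(3)] that by (auto simp: \<phi> hom L_ops M.smult_l_distr)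
    show "\<phi> (a \<odot>\<^bsub>M\<^esub> u) l = \<phi> u (a \<odot>\<^bsub>?L\<^esub> l)"
      if a: "a \<in> carrier R" and u: "u \<in> carrier M" and l: "l \<in> carrier ?L" for a u l
    proof -
      obtain s where s: "s \<in> carrier R" "l = ?I +> s" using L_carr[OF l] by blast
      show ?thesis
        using a u s(1) M.smult_assoc1[OF s(1) a u] M.m_comm[OF a s(1)] by (simp add: s(2) \<phi> L_ops)
    qed
  qed blast
  have one: "?I +> \<one> \<in> carrier ?L"
    using ring_hom_closed[OF I.rcos_ring_hom] by (simp add: quotient_module_def)
  have "B +>\<^bsub>M\<^esub> x = \<one>\<^bsub>?A\<^esub>"
    using h_ker[OF ker] h[OF x one] \<phi>[of \<one> x] x by simp
  then have "B +>\<^bsub>M\<^esub> x = B" by (simp add: A_FactGroup_def FactGroup_def)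
  with B.a_rcos_self[OF x] have "x \<in> B" by (rule subst[of _ _ "\<lambda>C. x \<in> C", rotated])
  then show ?thesis unfolding B_def by blast
qed

text \<open>
  The element \<open>fu \<otimes> 1 = u \<otimes> f\<close> is zero in \<open>M \<otimes> R/fR\<close>; by purity it is already zero in
  \<open>N \<otimes> R/fR\<close>.
\<close>

lemma pure_submodule_divisible:
  fixes M :: "('r, 'a) module" and R (structure)
  assumes M: "module R M" and pure: "pure_submodule R M N"
    and f: "f \<in> carrier R" and u: "u \<in> carrier M" and fu: "f \<odot>\<^bsub>M\<^esub> u \<in> N"
  shows "\<exists>w \<in> N. f \<odot>\<^bsub>M\<^esub> u = f \<odot>\<^bsub>M\<^esub> w"
proof -
  interpret M: module R M by fact
  let ?I = "PIdl f" let ?L = "quotient_module R ?I" let ?N = "M\<lparr>carrier := N\<rparr>"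
  interpret I: ideal ?I R using M.cgenideal_ideal[OF f] .
  have L: "module R ?L" using quotient_module_module[OF M.is_cring I.is_ideal] .
  interpret L: module R ?L by fact
  have N: "submodule N R M" using pure by (simp add: pure_submodule_def)
  let ?e = "?I +> \<one>"
  have e: "?e \<in> carrier ?L"
    using ring_hom_closed[OF I.rcos_ring_hom] by (simp add: quotient_module_def)
  have "f \<odot>\<^bsub>?L\<^esub> ?e = ?I +> f"
    using f ring_hom_mult[OF I.rcos_ring_hom, of f \<one>] by (simp add: quotient_module_def)
  also have "\<dots> = \<zero>\<^bsub>?L\<^esub>"
    using M.R.a_coset_join2[OF f I.a_subgroup M.cgenideal_self[OF f]] 
    by (simp add: quotient_module_def FactRing_def)
  finally have fe: "f \<odot>\<^bsub>?L\<^esub> ?e = \<zero>\<^bsub>?L\<^esub>" .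
  note K = tensor_kernel_closed[OF M L] and rel = tensor_kernel_relators[THEN subsetD]
  \<comment> \<open>The relation \<open>u \<otimes> (0 + 0) - u \<otimes> 0 - u \<otimes> 0\<close>.\<close>
  have zero: "- frag_of (u, \<zero>\<^bsub>?L\<^esub>) \<in> tensor_kernel R M ?L"
    using rel[OF tensor_relators.add_right[OF u L.M.zero_closed L.M.zero_closed]] by simp
  have "frag_of (f \<odot>\<^bsub>M\<^esub> u, ?e) - frag_of (u, \<zero>\<^bsub>?L\<^esub>) \<in> tensor_kernel R M ?L"
    using rel[OF tensor_relators.balanced[where M = M, OF f u e]] by (simp add: fe)
  from K(4)[OF this K(3)[OF zero]]
  have in_M: "frag_of (f \<odot>\<^bsub>M\<^esub> u, ?e) \<in> tensor_kernel R M ?L"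
    by simp
  have keys: "Poly_Mapping.keys (frag_of (f \<odot>\<^bsub>M\<^esub> u, ?e)) \<subseteq> N \<times> carrier ?L"
    using fu e by simp
  have "frag_of (f \<odot>\<^bsub>M\<^esub> u, ?e) \<in> tensor_kernel R ?N ?L"
    using inj_on_tensor_map_iff[THEN iffD1, OF M L N pure_submodule_universal[OF M L pure]]
      in_M keys by blast
  from tensor_kernel_principal[OF submodule.submodule_is_module[OF N M] f _ this] fu
  show ?thesis by simp
qed

lemma pure_cyclic_regular:
  fixes M :: "('r, 'a) module" and R (structure)
  assumes M: "module R M" and f: "f \<in> carrier R" and u: "u \<in> carrier M"
    and pure: "pure_submodule R M (cyclic_submodule R M (f \<odot>\<^bsub>M\<^esub> u))"
  shows "\<exists>a \<in> carrier R. f \<odot>\<^bsub>M\<^esub> u = a \<odot>\<^bsub>M\<^esub> (f \<odot>\<^bsub>M\<^esub> (f \<odot>\<^bsub>M\<^esub> u))"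
proof -
  interpret M: module R M by fact
  have "f \<odot>\<^bsub>M\<^esub> u \<in> cyclic_submodule R M (f \<odot>\<^bsub>M\<^esub> u)"
    unfolding cyclic_submodule_def
    using M.smult_one[OF M.smult_closed[OF f u]] by (intro CollectI exI[of _ \<one>]) simp
  from pure_submodule_divisible[OF M pure f u this]
  obtain w where w: "w \<in> cyclic_submodule R M (f \<odot>\<^bsub>M\<^esub> u)"
    "f \<odot>\<^bsub>M\<^esub> u = f \<odot>\<^bsub>M\<^esub> w"
    by (rule bexE)
  from w(1) obtain a where a: "a \<in> carrier R" "w = a \<odot>\<^bsub>M\<^esub> (f \<odot>\<^bsub>M\<^esub> u)"
    unfolding cyclic_submodule_def by blast
  note eq = w(2)[unfolded a(2)]
  have "f \<odot>\<^bsub>M\<^esub> (a \<odot>\<^bsub>M\<^esub> z) = a \<odot>\<^bsub>M\<^esub> (f \<odot>\<^bsub>M\<^esub> z)" if "z \<in> carrier M" for z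
    using M.smult_assoc1[of f a z] M.smult_assoc1[of a f z] M.m_comm[of a f] a(1) f that by simp
  then have "f \<odot>\<^bsub>M\<^esub> (a \<odot>\<^bsub>M\<^esub> (f \<odot>\<^bsub>M\<^esub> u)) = a \<odot>\<^bsub>M\<^esub> (f \<odot>\<^bsub>M\<^esub> (f \<odot>\<^bsub>M\<^esub> u))"
    using M.smult_closed[OF f u] .
  then have "f \<odot>\<^bsub>M\<^esub> u = a \<odot>\<^bsub>M\<^esub> (f \<odot>\<^bsub>M\<^esub> (f \<odot>\<^bsub>M\<^esub> u))" by (rule trans[OF eq])
  then show ?thesis by (rule bexI[rotated, OF a(1)])
qed

section \<open>Homogeneous components\<close>

text \<open>
  The kernel of the projection onto \<open>G e\<close>. Asking for some decomposition instead of the unique one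
  makes closure under addition a matter of adding decompositions; uniqueness enters when this set is
  compared with \<open>G e\<close>.
\<close>

definition no_component :: "('r, 'a) module \<Rightarrow> ('d \<Rightarrow> 'a set) \<Rightarrow> 'd \<Rightarrow> 'a set" where
  "no_component M G e = {u. \<exists>c. (\<forall>d. c d \<in> G d) \<and> finite {d. c d \<noteq> \<zero>\<^bsub>M\<^esub>} \<and>
     u = (\<Oplus>\<^bsub>M\<^esub> d \<in> {d. c d \<noteq> \<zero>\<^bsub>M\<^esub>}. c d) \<and> c e = \<zero>\<^bsub>M\<^esub>}"

lemma homogeneous_decomposition:
  fixes M :: "('r, 'a) module"
  assumes M: "abelian_group M" and G: "\<And>d. subgroup (G d) (add_monoid M)" and u: "u \<in> G d"
  defines "c \<equiv> \<lambda>d'. if d' = d then u else \<zero>\<^bsub>M\<^esub>"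
  shows "\<forall>d'. c d' \<in> G d'" and "finite {d'. c d' \<noteq> \<zero>\<^bsub>M\<^esub>}"
    and "u = (\<Oplus>\<^bsub>M\<^esub> d' \<in> {d'. c d' \<noteq> \<zero>\<^bsub>M\<^esub>}. c d')"
proof -
  interpret M: abelian_group M by fact
  have u': "u \<in> carrier M" using subgroup.subset[OF G] u by auto
  show "\<forall>d'. c d' \<in> G d'" using u subgroup.one_closed[OF G] by (auto simp: c_def)
  show "finite {d'. c d' \<noteq> \<zero>\<^bsub>M\<^esub>}" by (simp add: c_def)
  have "(\<Oplus>\<^bsub>M\<^esub> d' \<in> {d'. c d' \<noteq> \<zero>\<^bsub>M\<^esub>}. c d') = (\<Oplus>\<^bsub>M\<^esub> d' \<in> {d}. c d')"
    by (rule M.add.finprod_mono_neutral_cong_left) (use u' in \<open>auto simp: c_def\<close>)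
  also have "\<dots> = u" using u' by (simp add: c_def)
  finally show "u = (\<Oplus>\<^bsub>M\<^esub> d' \<in> {d'. c d' \<noteq> \<zero>\<^bsub>M\<^esub>}. c d')" ..
qed

lemma no_component_homogeneous:
  assumes "abelian_group M" "\<And>d. subgroup (G d) (add_monoid M)" "u \<in> G d" "d \<noteq> e"
  shows "u \<in> no_component M G e"
  using homogeneous_decomposition[of M G u d, OF assms(1,2)] assms(3,4)
  unfolding no_component_def by (intro CollectI exI[of _ "\<lambda>d'. if d' = d then u else \<zero>\<^bsub>M\<^esub>"] conjI) auto

lemma no_component_add:
  fixes M :: "('r, 'a) module"
  assumes M: "abelian_group M" and G: "\<And>d. subgroup (G d) (add_monoid M)"
    and "u \<in> no_component M G e" "v \<in> no_component M G e"
  shows "u \<oplus>\<^bsub>M\<^esub> v \<in> no_component M G e"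
proof -
  interpret M: abelian_group M by fact
  obtain a b where a: "\<forall>d. a d \<in> G d" "finite {d. a d \<noteq> \<zero>\<^bsub>M\<^esub>}" "a e = \<zero>\<^bsub>M\<^esub>"
    and u: "u = (\<Oplus>\<^bsub>M\<^esub> d \<in> {d. a d \<noteq> \<zero>\<^bsub>M\<^esub>}. a d)"
    and b: "\<forall>d. b d \<in> G d" "finite {d. b d \<noteq> \<zero>\<^bsub>M\<^esub>}" "b e = \<zero>\<^bsub>M\<^esub>"
    and v: "v = (\<Oplus>\<^bsub>M\<^esub> d \<in> {d. b d \<noteq> \<zero>\<^bsub>M\<^esub>}. b d)"
    using assms(3,4) by (auto simp: no_component_def)
  let ?c = "\<lambda>d. a d \<oplus>\<^bsub>M\<^esub> b d"
  let ?D = "{d. a d \<noteq> \<zero>\<^bsub>M\<^esub>} \<union> {d. b d \<noteq> \<zero>\<^bsub>M\<^esub>}"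
  have carr: "a d \<in> carrier M" "b d \<in> carrier M" for d
    using a(1) b(1) subgroup.subset[OF G, of d] by auto
  have fin: "finite ?D" using a(2) b(2) by simp
  have sub: "{d. ?c d \<noteq> \<zero>\<^bsub>M\<^esub>} \<subseteq> ?D" by auto
  have extend: "(\<Oplus>\<^bsub>M\<^esub> d \<in> {d. g d \<noteq> \<zero>\<^bsub>M\<^esub>}. g d) = (\<Oplus>\<^bsub>M\<^esub> d \<in> ?D. g d)"
    if "{d. g d \<noteq> \<zero>\<^bsub>M\<^esub>} \<subseteq> ?D" "\<And>d. g d \<in> carrier M" for g
    by (rule M.add.finprod_mono_neutral_cong_left[OF fin that(1)]) (use that in auto)
  have "u \<oplus>\<^bsub>M\<^esub> v = (\<Oplus>\<^bsub>M\<^esub> d \<in> ?D. ?c d)"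
    using carr by (simp add: u v extend M.finsum_addf)
  also have "\<dots> = (\<Oplus>\<^bsub>M\<^esub> d \<in> {d. ?c d \<noteq> \<zero>\<^bsub>M\<^esub>}. ?c d)"
    by (rule extend[symmetric]) (use sub carr in auto)
  finally have "u \<oplus>\<^bsub>M\<^esub> v = \<dots>" .
  moreover have "\<forall>d. ?c d \<in> G d"
    using a(1) b(1) subgroup.m_closed[OF G] by auto
  moreover have "finite {d. ?c d \<noteq> \<zero>\<^bsub>M\<^esub>}" using finite_subset[OF sub fin] .
  moreover have "?c e = \<zero>\<^bsub>M\<^esub>" using a(3) b(3) by simp
  ultimately show ?thesis unfolding no_component_def by (intro CollectI exI[of _ ?c] conjI)
qed

lemma no_component_homogeneous_zero:
  fixes M :: "(('k::field) poly2, 'a) module"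
  assumes bigr: "bigraded_module m n M G" and u: "u \<in> G e" "u \<in> no_component M G e"
  shows "u = \<zero>\<^bsub>M\<^esub>"
proof -
  interpret M: module "bipoly_ring m n" M using bigr by (simp add: bigraded_module_def)
  have G: "\<And>d. subgroup (G d) (add_monoid M)" using bigr unfolding bigraded_module_def by blast
  have "u \<in> carrier M" using subgroup.subset[OF G, of e] u(1) by auto
  then have ex1: "\<exists>!c. (\<forall>d. c d \<in> G d) \<and> finite {d. c d \<noteq> \<zero>\<^bsub>M\<^esub>} \<and>
      u = (\<Oplus>\<^bsub>M\<^esub> d \<in> {d. c d \<noteq> \<zero>\<^bsub>M\<^esub>}. c d)"
    using bigr by (simp add: bigraded_module_def)
  obtain c where c: "\<forall>d. c d \<in> G d" "finite {d. c d \<noteq> \<zero>\<^bsub>M\<^esub>}"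
    "u = (\<Oplus>\<^bsub>M\<^esub> d \<in> {d. c d \<noteq> \<zero>\<^bsub>M\<^esub>}. c d)" and ce: "c e = \<zero>\<^bsub>M\<^esub>"
    using u(2) by (auto simp: no_component_def)
  note sing = homogeneous_decomposition[of M G u e, OF M.M.abelian_group_axioms G u(1)]
  have "c = (\<lambda>d. if d = e then u else \<zero>\<^bsub>M\<^esub>)"
    using the1_equality[OF ex1, OF conjI[OF c(1) conjI[OF c(2,3)]]]
      the1_equality[OF ex1, OF conjI[OF sing(1) conjI[OF sing(2,3)]]] by (rule trans[OF sym])
  then have "c e = u" by simp
  then show ?thesis using ce by simp
qed

section \<open>The variables act as zero\<close>

lemma bipoly_ring_ops [simp]:
  "f \<oplus>\<^bsub>bipoly_ring m n\<^esub> g = f + g" "f \<otimes>\<^bsub>bipoly_ring m n\<^esub> g = f * g"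
  "\<zero>\<^bsub>bipoly_ring m n\<^esub> = 0" "\<one>\<^bsub>bipoly_ring m n\<^esub> = 1"
  by (simp_all add: bipoly_ring_def)

lemma monomial_in_bipoly_ring:
  "Poly_Mapping.keys t \<subseteq> vars2 m n \<Longrightarrow>
    Poly_Mapping.single t c \<in> carrier (bipoly_ring m n :: ('k::field) poly2 ring)"
  by (simp add: bipoly_ring_def)

lemma bipoly_induct [consumes 1, case_names zero monomial add]:
  assumes f: "f \<in> carrier (bipoly_ring m n)"
    and zero: "P 0"
    and monomial: "\<And>t c. Poly_Mapping.keys t \<subseteq> vars2 m n \<Longrightarrow> P (Poly_Mapping.single t c)"
    and add: "\<And>f g. f \<in> carrier (bipoly_ring m n) \<Longrightarrow> g \<in> carrier (bipoly_ring m n) \<Longrightarrow>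
      P f \<Longrightarrow> P g \<Longrightarrow> P (f + g)"
  shows "P (f :: ('k::field) poly2)"
proof -
  interpret S: cring "bipoly_ring m n :: 'k poly2 ring" by (rule bipoly_ring_cring)
  let ?mon = "\<lambda>t. Poly_Mapping.single t (Poly_Mapping.lookup f t)"
  have mon: "?mon t \<in> carrier (bipoly_ring m n)" "P (?mon t)" if "t \<in> Poly_Mapping.keys f" for t
  proof -
    have "Poly_Mapping.keys t \<subseteq> vars2 m n" using f that by (simp add: bipoly_ring_def)
    then show "?mon t \<in> carrier (bipoly_ring m n)" "P (?mon t)"
      by (rule monomial_in_bipoly_ring monomial)+
  qed
  have "sum ?mon A \<in> carrier (bipoly_ring m n) \<and> P (sum ?mon A)"
    if "A \<subseteq> Poly_Mapping.keys f" for A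
    using finite_subset[OF that finite_keys] that
  proof (induction A)
    case empty
    then show ?case using zero S.zero_closed by simp
  next
    case (insert t A)
    then have t: "t \<in> Poly_Mapping.keys f"
      and IH: "sum ?mon A \<in> carrier (bipoly_ring m n)" "P (sum ?mon A)" by auto
    have "sum ?mon (insert t A) = ?mon t + sum ?mon A" using insert.hyps by simp
    then show ?case
      using add[OF mon(1)[OF t] IH(1) mon(2)[OF t] IH(2)] S.a_closed[OF mon(1)[OF t] IH(1)]
      by simp
  qed
  moreover have "sum ?mon (Poly_Mapping.keys f) = f"
    by (rule poly_mapping_eqI)
      (simp add: lookup_sum lookup_single when_def in_keys_iff)
  ultimately show ?thesis using order_refl[of "Poly_Mapping.keys f"] by metis
qed

text \<open>
  Degrees of polynomials are nonnegative, so multiplication cannot lower either coordinate of a degree.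
\<close>

lemma smult_no_component:
  fixes M :: "(('k::field) poly2, 'a) module"
  assumes bigr: "bigraded_module m n M G" and w: "w \<in> G d"
    and f: "f \<in> carrier (bipoly_ring m n)"
    and lt: "fst e < fst d \<or> snd e < snd d"
  shows "f \<odot>\<^bsub>M\<^esub> w \<in> no_component M G e"
proof -
  interpret M: module "bipoly_ring m n" M using bigr by (simp add: bigraded_module_def)
  have G: "\<And>d. subgroup (G d) (add_monoid M)" using bigr unfolding bigraded_module_def by blast
  have wc: "w \<in> carrier M" using subgroup.subset[OF G, of d] w by auto
  note hom = no_component_homogeneous[of M G, OF M.M.abelian_group_axioms G]
  show ?thesis
    using f
  proof (induction rule: bipoly_induct)
    case zero
    have "\<zero>\<^bsub>M\<^esub> \<in> G d" using subgroup.one_closed[OF G, of d] by simp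
    moreover have "d \<noteq> e" using lt by auto
    ultimately show ?case using hom[of "\<zero>\<^bsub>M\<^esub>" d e] M.smult_l_null[OF wc] by simp
  next
    case (monomial t c)
    let ?b = "bidegree m n t"
    have "Poly_Mapping.single t c \<in> bipoly_part m n ?b"
      using monomial by (simp add: bipoly_part_def bipoly_ring_def)
    then have "Poly_Mapping.single t c \<odot>\<^bsub>M\<^esub> w \<in> G (fst ?b + fst d, snd ?b + snd d)"
      using bigr w by (simp add: bigraded_module_def)
    moreover have "0 \<le> fst ?b" "0 \<le> snd ?b" by (simp_all add: bidegree_def sum_nonneg)
    then have "(fst ?b + fst d, snd ?b + snd d) \<noteq> e" using lt by auto
    ultimately show ?case by (rule hom)
  next
    case (add f g)
    then show ?case
      using no_component_add[of M G, OF M.M.abelian_group_axioms G] M.smult_l_distr[of f g w] wc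
      by simp
  qed
qed

text \<open>
  In \<open>x w = a x\<^sup>2 w\<close> the left-hand side is homogeneous, and the right-hand side has no component in
  its degree.
\<close>

lemma variable_annihilates_homogeneous:
  fixes M :: "(('k::field) poly2, 'a) module"
  assumes bigr: "bigraded_module m n M G" and w: "w \<in> G d" and v: "v \<in> vars2 m n"
    and reg: "\<exists>a \<in> carrier (bipoly_ring m n).
      Var2 v \<odot>\<^bsub>M\<^esub> w = a \<odot>\<^bsub>M\<^esub> (Var2 v \<odot>\<^bsub>M\<^esub> (Var2 v \<odot>\<^bsub>M\<^esub> w))"
  shows "Var2 v \<odot>\<^bsub>M\<^esub> w = \<zero>\<^bsub>M\<^esub>"
proof -
  define b where "b = bidegree m n (Poly_Mapping.single v 1)"
  have "fst b = (if \<exists>i\<in>{1..m}. v = Inl i then 1 else 0)"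
    "snd b = (if \<exists>j\<in>{1..n}. v = Inr j then 1 else 0)"
    by (auto simp: b_def bidegree_def lookup_single when_def simp flip: of_nat_sum)
  then have b: "0 < fst b \<or> 0 < snd b"
    using v by (auto simp: vars2_def)
  have "Var2 v \<in> bipoly_part m n b"
    using v by (auto simp: bipoly_part_def bipoly_ring_def Var2_def b_def)
  then have raise: "Var2 v \<odot>\<^bsub>M\<^esub> z \<in> G (fst b + fst d, snd b + snd d)" if "z \<in> G d" for z d
    using that bigr unfolding bigraded_module_def by blast
  from reg obtain a where a: "a \<in> carrier (bipoly_ring m n)"
    "Var2 v \<odot>\<^bsub>M\<^esub> w = a \<odot>\<^bsub>M\<^esub> (Var2 v \<odot>\<^bsub>M\<^esub> (Var2 v \<odot>\<^bsub>M\<^esub> w))"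
    by blast
  have "Var2 v \<odot>\<^bsub>M\<^esub> w \<in> no_component M G (fst b + fst d, snd b + snd d)"
    using smult_no_component[OF bigr raise[OF raise[OF w]] a(1)] b by (simp add: a(2)[symmetric])
  then show ?thesis using no_component_homogeneous_zero[OF bigr raise[OF w]] by blast
qed

lemma variable_annihilates:
  fixes M :: "(('k::field) poly2, 'a) module"
  assumes bigr: "bigraded_module m n M G" and v: "v \<in> vars2 m n"
    and pure: "\<forall>u \<in> carrier M.
      pure_submodule (bipoly_ring m n) M (cyclic_submodule (bipoly_ring m n) M u)"
    and u: "u \<in> carrier M"
  shows "Var2 v \<odot>\<^bsub>M\<^esub> u = \<zero>\<^bsub>M\<^esub>"
proof -
  have mod: "module (bipoly_ring m n) M" using bigr by (simp add: bigraded_module_def)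
  interpret M: module "bipoly_ring m n" M by (rule mod)
  have G: "\<And>d. subgroup (G d) (add_monoid M)" using bigr unfolding bigraded_module_def by blast
  have Gc: "G d \<subseteq> carrier M" for d using subgroup.subset[OF G, of d] by simp
  have x: "Var2 v \<in> carrier (bipoly_ring m n)"
    using v by (auto simp: bipoly_ring_def Var2_def)
  have kill: "Var2 v \<odot>\<^bsub>M\<^esub> w = \<zero>\<^bsub>M\<^esub>" if "w \<in> G d" for w d
  proof (rule variable_annihilates_homogeneous[OF bigr that v])
    have w: "w \<in> carrier M" using Gc that by blast
    show "\<exists>a \<in> carrier (bipoly_ring m n).
      Var2 v \<odot>\<^bsub>M\<^esub> w = a \<odot>\<^bsub>M\<^esub> (Var2 v \<odot>\<^bsub>M\<^esub> (Var2 v \<odot>\<^bsub>M\<^esub> w))"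
      using pure_cyclic_regular[OF mod x w] pure M.smult_closed[OF x w] by blast
  qed
  have "\<exists>c. (\<forall>d. c d \<in> G d) \<and> finite {d. c d \<noteq> \<zero>\<^bsub>M\<^esub>} \<and>
      u = (\<Oplus>\<^bsub>M\<^esub> d \<in> {d. c d \<noteq> \<zero>\<^bsub>M\<^esub>}. c d)"
    using bigr u unfolding bigraded_module_def by blast
  then obtain c where c: "\<forall>d. c d \<in> G d" "finite {d. c d \<noteq> \<zero>\<^bsub>M\<^esub>}"
    "u = (\<Oplus>\<^bsub>M\<^esub> d \<in> {d. c d \<noteq> \<zero>\<^bsub>M\<^esub>}. c d)" by blast
  have "Var2 v \<odot>\<^bsub>M\<^esub> u = (\<Oplus>\<^bsub>M\<^esub> d \<in> {d. c d \<noteq> \<zero>\<^bsub>M\<^esub>}. Var2 v \<odot>\<^bsub>M\<^esub> c d)"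
    unfolding c(3) by (rule M.finsum_smult_ldistr[OF c(2) x]) (use c(1) Gc in blast)
  also have "\<dots> = (\<Oplus>\<^bsub>M\<^esub> d \<in> {d. c d \<noteq> \<zero>\<^bsub>M\<^esub>}. \<zero>\<^bsub>M\<^esub>)"
    by (rule M.M.finsum_cong') (use kill[OF spec[OF c(1)]] in auto)
  finally show ?thesis by simp
qed

section \<open>Annihilators\<close>

lemma single_monomial_split:
  assumes "v \<in> Poly_Mapping.keys t"
  shows "Poly_Mapping.single t c =
    Poly_Mapping.single (t - Poly_Mapping.single v 1) c * (Var2 v :: ('k::field) poly2)"
proof -
  have "t = (t - Poly_Mapping.single v 1) + Poly_Mapping.single v 1"
    by (rule poly_mapping_eqI)
      (use assms in \<open>auto simp: lookup_add lookup_minus lookup_single when_def in_keys_iff\<close>)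
  then show ?thesis by (simp add: Var2_def mult_single)
qed

lemma smult_constant_term:
  fixes M :: "(('k::field) poly2, 'a) module"
  assumes mod: "module (bipoly_ring m n) M" and u: "u \<in> carrier M"
    and kill: "\<And>v w. v \<in> vars2 m n \<Longrightarrow> w \<in> carrier M \<Longrightarrow> Var2 v \<odot>\<^bsub>M\<^esub> w = \<zero>\<^bsub>M\<^esub>"
    and f: "f \<in> carrier (bipoly_ring m n)"
  shows "f \<odot>\<^bsub>M\<^esub> u = Poly_Mapping.single 0 (Poly_Mapping.lookup f 0) \<odot>\<^bsub>M\<^esub> u"
proof -
  interpret M: module "bipoly_ring m n" M by (rule mod)
  have const: "Poly_Mapping.single 0 c \<in> carrier (bipoly_ring m n)" for c :: 'k
    by (rule monomial_in_bipoly_ring) simp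
  have null: "0 \<odot>\<^bsub>M\<^esub> u = \<zero>\<^bsub>M\<^esub>"
    using M.smult_l_null[OF u] by simp
  show ?thesis
    using f
  proof (induction rule: bipoly_induct)
    case (monomial t c)
    show ?case
    proof (cases "t = 0")
      case False
      then obtain v where v: "v \<in> Poly_Mapping.keys t" by fastforce
      let ?g = "Poly_Mapping.single (t - Poly_Mapping.single v 1) c"
      have g: "?g \<in> carrier (bipoly_ring m n)" and x: "Var2 v \<in> carrier (bipoly_ring m n)"
        using monomial v keys_diff[of t "Poly_Mapping.single v 1"]
        by (auto simp: bipoly_ring_def Var2_def in_keys_iff lookup_minus)
      have "Poly_Mapping.single t c \<odot>\<^bsub>M\<^esub> u = ?g \<odot>\<^bsub>M\<^esub> (Var2 v \<odot>\<^bsub>M\<^esub> u)"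
        using M.smult_assoc1[OF g x u] by (simp add: single_monomial_split[OF v])
      also have "\<dots> = \<zero>\<^bsub>M\<^esub>" using kill[of v u] monomial v u g by auto
      finally show ?thesis using False null by (simp add: lookup_single)
    qed simp
  next
    case (add f g)
    then show ?case
      using M.smult_l_distr[of f g u] u
        M.smult_l_distr[OF const[of "Poly_Mapping.lookup f 0"] const[of "Poly_Mapping.lookup g 0"], of u]
      by (simp add: lookup_add single_add)
  qed (simp add: null)
qed

text \<open>A nonzero constant term is a unit of the coefficient field, so it cannot annihilate \<open>u\<close>.\<close>

lemma elem_annihilator_eq_irrelevant:
  fixes M :: "(('k::field) poly2, 'a) module"
  assumes mod: "module (bipoly_ring m n) M" and u: "u \<in> carrier M" "u \<noteq> \<zero>\<^bsub>M\<^esub>"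
    and kill: "\<And>v w. v \<in> vars2 m n \<Longrightarrow> w \<in> carrier M \<Longrightarrow> Var2 v \<odot>\<^bsub>M\<^esub> w = \<zero>\<^bsub>M\<^esub>"
  shows "elem_annihilator (bipoly_ring m n) M u =
    {f \<in> carrier (bipoly_ring m n). Poly_Mapping.lookup f 0 = 0}"
proof -
  interpret M: module "bipoly_ring m n" M by (rule mod)
  have const: "Poly_Mapping.single 0 c \<in> carrier (bipoly_ring m n)" for c :: 'k
    by (rule monomial_in_bipoly_ring) simp
  have "Poly_Mapping.single 0 c \<odot>\<^bsub>M\<^esub> u = \<zero>\<^bsub>M\<^esub> \<longleftrightarrow> c = 0" for c
  proof
    assume z: "Poly_Mapping.single 0 c \<odot>\<^bsub>M\<^esub> u = \<zero>\<^bsub>M\<^esub>"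
    show "c = 0"
    proof (rule ccontr)
      assume "c \<noteq> 0"
      then have "u = (Poly_Mapping.single 0 (inverse c) \<otimes>\<^bsub>bipoly_ring m n\<^esub> Poly_Mapping.single 0 c) \<odot>\<^bsub>M\<^esub> u"
        using M.smult_one[OF u(1)] by (simp add: mult_single)
      also have "\<dots> = \<zero>\<^bsub>M\<^esub>"
        using M.smult_assoc1[OF const const u(1)] z const by simp
      finally show False using u(2) by simp
    qed
  next
    assume "c = 0"
    then show "Poly_Mapping.single 0 c \<odot>\<^bsub>M\<^esub> u = \<zero>\<^bsub>M\<^esub>"
      using M.smult_l_null[OF u(1)] by simp
  qed
  then show ?thesis
    unfolding elem_annihilator_def by (intro Collect_cong conj_cong refl)
      (simp only: smult_constant_term[OF mod u(1) kill])
qed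

theorem proposition1p19:
  fixes M :: "(('k::field) poly2, 'a) module"
    and G :: "int \<times> int \<Rightarrow> 'a set"
    and m n p q :: nat
  defines "S \<equiv> bipoly_ring m n :: 'k poly2 ring"
    and "P \<equiv> ideal_P m n :: 'k poly2 set"
    and "Q \<equiv> ideal_Q m n :: 'k poly2 set"
  assumes "infinite (UNIV :: 'k set)"
    and "bigraded_module m n M G"
    and "finitely_generated S M"
    and "carrier M \<noteq> {\<zero>\<^bsub>M\<^esub>}"
    and "\<forall>u \<in> carrier M. pure_submodule S M (cyclic_submodule S M u)"
    and "relative_CM S P M"
    and "cd S P M = p"
    and "relative_unmixed S Q M"
    and "cd S Q M = q"
  shows "unmixed S M"
proof -
  have mod: "module S M"
    using \<open>bigraded_module m n M G\<close> by (simp add: bigraded_module_def S_def)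
  interpret M: module S M by (rule mod)
  let ?I = "{f \<in> carrier S. Poly_Mapping.lookup f 0 = 0}"
  have kill: "Var2 v \<odot>\<^bsub>M\<^esub> w = \<zero>\<^bsub>M\<^esub>" if "v \<in> vars2 m n" "w \<in> carrier M" for v w
    using variable_annihilates[OF \<open>bigraded_module m n M G\<close> that(1) _ that(2)]
      \<open>\<forall>u \<in> carrier M. pure_submodule S M (cyclic_submodule S M u)\<close> by (simp add: S_def)
  have ann_elem: "elem_annihilator S M u = ?I" if "u \<in> carrier M" "u \<noteq> \<zero>\<^bsub>M\<^esub>" for u
    using elem_annihilator_eq_irrelevant[of m n M u] mod that kill by (simp add: S_def)
  obtain u\<^sub>0 where u0: "u\<^sub>0 \<in> carrier M" "u\<^sub>0 \<noteq> \<zero>\<^bsub>M\<^esub>"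
    using \<open>carrier M \<noteq> {\<zero>\<^bsub>M\<^esub>}\<close> M.M.zero_closed by blast
  have ann: "annihilator S M = ?I"
  proof
    show "annihilator S M \<subseteq> ?I"
      using ann_elem[OF u0] u0(1) by (auto simp: annihilator_def elem_annihilator_def)
    show "?I \<subseteq> annihilator S M"
    proof
      fix f assume f: "f \<in> ?I"
      then have "f \<odot>\<^bsub>M\<^esub> u = \<zero>\<^bsub>M\<^esub>" if "u \<in> carrier M" for u
        using ann_elem[OF that] by (cases "u = \<zero>\<^bsub>M\<^esub>") (auto simp: elem_annihilator_def)
      then show "f \<in> annihilator S M" using f by (simp add: annihilator_def)
    qed
  qed
  have "I = ?I" if "I \<in> Ass S M" for I
  proof -
    from that have "primeideal I S \<and> (\<exists>u\<in>carrier M. I = elem_annihilator S M u)"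
      unfolding Ass_def mem_Collect_eq .
    then obtain u where u: "u \<in> carrier M" "I = elem_annihilator S M u" and I: "primeideal I S"
      by (elim conjE bexE)
    have "u \<noteq> \<zero>\<^bsub>M\<^esub>"
    proof
      assume "u = \<zero>\<^bsub>M\<^esub>"
      then have "I = carrier S" using u(2) by (auto simp: elem_annihilator_def)
      with primeideal.I_notcarr[OF I] show False by (rule notE[OF not_sym])
    qed
    show ?thesis unfolding u(2) by (rule ann_elem[OF u(1) \<open>u \<noteq> \<zero>\<^bsub>M\<^esub>\<close>])
  qed
  then show ?thesis unfolding unmixed_def module_dim_def ann by blast
qed

end
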